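(* Let $A$ be a compatible associative algebra. If $H^3_c(A,A)=0$ then any finite order deformation of $A$ is extensible.
   Context: All vector spaces are finite-dimensional over a field $\mathbb{K}$ of characteristic $0$. A compatible associative algebra is a triple $(A,\mu_1,\mu_2)$ of a vector space with two associative bilinear products, written $a\cdot_1 b$ and $a\cdot_2 b$, with $(a\cdot_1 b)\cdot_2 c+(a\cdot_2 b)\cdot_1 c=a\cdot_1(b\cdot_2 c)+a\cdot_2(b\cdot_1 c)$ for all $a,b,c$ (and similarly over a commutative ring). Cohomology: let $C^n(A,A)=\mathrm{Hom}(A^{\otimes n},A)$ and, for $i=1,2$, let $\delta_i:C^n(A,A)\to C^{n+1}(A,A)$ be the Hochschild coboundary of $(A,\mu_i)$: $(\delta_if)(a_1,\ldots,a_{n+1})=a_1\cdot_if(a_2,\ldots,a_{n+1})+\sum_{k=1}^n(-1)^kf(a_1,\ldots,a_k\cdot_ia_{k+1},\ldots,a_{n+1})+(-1)^{n+1}f(a_1,\ldots,a_n)\cdot_ia_{n+1}$. $H^*_c(A,A)$ is the cohomology of the complex with $C^0_c(A,A)=\{m\in A\mid a\cdot_1m-m\cdot_1a=a\cdot_2m-m\cdot_2a\ \forall a\in A\}$, $C^n_c(A,A)=C^n(A,A)^{\oplus n}$ for $n\ge1$, $\delta_c(m)(a)=a\cdot_1m-m\cdot_1a=a\cdot_2m-m\cdot_2a$ on $C^0_c$, and $\delta_c(f_1,\ldots,f_n)=(\delta_1f_1,\ldots,\delta_1f_i+\delta_2f_{i-1},\ldots,\delta_2f_n)$ for $n\ge1$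 (the $i$-th entry being $\delta_1f_i+\delta_2f_{i-1}$ for $2\le i\le n$). For a natural number $N\ge1$, an order $N$ deformation of $A$ is a pair of polynomials $\mu_{1,t}^N=\sum_{i=0}^Nt^i\mu_{1,i}$, $\mu_{2,t}^N=\sum_{i=0}^Nt^i\mu_{2,i}$, with $\mu_{1,i},\mu_{2,i}$ bilinear maps on $A$, $\mu_{1,0}=\mu_1$, $\mu_{2,0}=\mu_2$, such that $(A[[t]]/(t^{N+1}),\mu_{1,t}^N,\mu_{2,t}^N)$ is a compatible associative algebra over $\mathbb{K}[[t]]/(t^{N+1})$. A finite order deformation is an order $N$ deformation for some $N$. It is extensible if there exist bilinear maps $\mu_{1,N+1},\mu_{2,N+1}$ on $A$ such that $(\mu_{1,t}^N+t^{N+1}\mu_{1,N+1},\ \mu_{2,t}^N+t^{N+1}\mu_{2,N+1})$ is an order $N+1$ deformation. *)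

theory Defs
  imports
    "HOL-Algebra.Module"
    "HOL-Computational_Algebra.Formal_Power_Series"
    "HOL-Library.Function_Algebras"
begin

section \<open>Compatible associative algebras over a commutative ring\<close>

definition bilinear_product ::
  "('r, 'm) ring_scheme \<Rightarrow> ('r, 'a, 'n) module_scheme \<Rightarrow> ('a \<Rightarrow> 'a \<Rightarrow> 'a) \<Rightarrow> bool" where
  "bilinear_product R M \<mu> \<longleftrightarrow>
     (\<forall>x\<in>carrier M. \<forall>y\<in>carrier M. \<mu> x y \<in> carrier M) \<and>
     (\<forall>x\<in>carrier M. \<forall>y\<in>carrier M. \<forall>z\<in>carrier M.
        \<mu> (x \<oplus>\<^bsub>M\<^esub> y) z = \<mu> x z \<oplus>\<^bsub>M\<^esub> \<mu> y z \<and>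
        \<mu> z (x \<oplus>\<^bsub>M\<^esub> y) = \<mu> z x \<oplus>\<^bsub>M\<^esub> \<mu> z y) \<and>
     (\<forall>r\<in>carrier R. \<forall>x\<in>carrier M. \<forall>y\<in>carrier M.
        \<mu> (r \<odot>\<^bsub>M\<^esub> x) y = r \<odot>\<^bsub>M\<^esub> \<mu> x y \<and>
        \<mu> x (r \<odot>\<^bsub>M\<^esub> y) = r \<odot>\<^bsub>M\<^esub> \<mu> x y)"

text \<open>The HOL-Algebra locale \<open>Module.module\<close> includes that \<open>R\<close> is a commutative ring.\<close>

definition compatible_associative_algebra ::
  "('r, 'm) ring_scheme \<Rightarrow> ('r, 'a, 'n) module_scheme \<Rightarrow>
     ('a \<Rightarrow> 'a \<Rightarrow> 'a) \<Rightarrow> ('a \<Rightarrow> 'a \<Rightarrow> 'a) \<Rightarrow> bool" where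
  "compatible_associative_algebra R M \<mu>1 \<mu>2 \<longleftrightarrow>
     Module.module R M \<and> bilinear_product R M \<mu>1 \<and> bilinear_product R M \<mu>2 \<and>
     (\<forall>a\<in>carrier M. \<forall>b\<in>carrier M. \<forall>c\<in>carrier M.
        \<mu>1 (\<mu>1 a b) c = \<mu>1 a (\<mu>1 b c) \<and>
        \<mu>2 (\<mu>2 a b) c = \<mu>2 a (\<mu>2 b c) \<and>
        \<mu>2 (\<mu>1 a b) c \<oplus>\<^bsub>M\<^esub> \<mu>1 (\<mu>2 a b) c = \<mu>1 a (\<mu>2 b c) \<oplus>\<^bsub>M\<^esub> \<mu>2 a (\<mu>1 b c))"

text \<open>
  A field and a vector space given by types, as records. The multiplicative fields of a
  module record play no role in \<open>Module.module\<close> and are left undefined.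
\<close>

definition scalar_ring :: "'k::field ring" where
  "scalar_ring = \<lparr>carrier = UNIV, monoid.mult = (*), one = 1, zero = 0, add = (+)\<rparr>"

definition scalar_module :: "('k::field \<Rightarrow> 'a::ab_group_add \<Rightarrow> 'a) \<Rightarrow> ('k, 'a) module" where
  "scalar_module scale =
     \<lparr>carrier = UNIV, monoid.mult = undefined, one = undefined, zero = 0, add = (+), smult = scale\<rparr>"

section \<open>Hochschild cochains and compatible cohomology\<close>

text \<open>
  An element of \<open>Hom(A\<^sup>\<otimes>\<^sup>n, A)\<close> is an \<open>n\<close>-multilinear function on argument lists of
  length \<open>n\<close>, set to \<open>0\<close> on all other lists. For \<open>n = 0\<close> it is its value at \<open>[]\<close>,
  an element of \<open>A\<close>.
\<close>

definition cochains ::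
  "('k::field \<Rightarrow> 'a::ab_group_add \<Rightarrow> 'a) \<Rightarrow> nat \<Rightarrow> ('a list \<Rightarrow> 'a) set" where
  "cochains scale n = {f.
     (\<forall>xs. length xs \<noteq> n \<longrightarrow> f xs = 0) \<and>
     (\<forall>xs i. length xs = n \<longrightarrow> i < n \<longrightarrow> Vector_Spaces.linear scale scale (\<lambda>x. f (xs[i := x])))}"

text \<open>The arguments \<open>a\<^sub>1, \<dots>, a\<^sub>n\<^sub>+\<^sub>1\<close> are \<open>xs ! 0, \<dots>, xs ! n\<close>.\<close>

definition hochschild_coboundary ::
  "('k::field \<Rightarrow> 'a::ab_group_add \<Rightarrow> 'a) \<Rightarrow> ('a \<Rightarrow> 'a \<Rightarrow> 'a) \<Rightarrow> nat \<Rightarrow>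
     ('a list \<Rightarrow> 'a) \<Rightarrow> 'a list \<Rightarrow> 'a" where
  "hochschild_coboundary scale \<mu> n f xs =
     (if length xs = n + 1 then
        \<mu> (xs ! 0) (f (drop 1 xs))
        + (\<Sum>k = 1..n. scale ((- 1) ^ k)
             (f (take (k - 1) xs @ [\<mu> (xs ! (k - 1)) (xs ! k)] @ drop (k + 1) xs)))
        + scale ((- 1) ^ (n + 1)) (\<mu> (f (take n xs)) (xs ! n))
      else 0)"

text \<open>
  An element \<open>(f\<^sub>1, \<dots>, f\<^sub>n)\<close> of \<open>C\<^sup>n(A,A)\<^sup>\<oplus>\<^sup>n\<close>, \<open>n \<ge> 1\<close>, is a family indexed by \<open>nat\<close> that
  vanishes outside \<open>{1..n}\<close>. An element \<open>m\<close> of degree \<open>0\<close> is the family with the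
  \<open>0\<close>-cochain \<open>m\<close> at index \<open>1\<close> and zeros elsewhere.
\<close>

definition compatible_cochains ::
  "('k::field \<Rightarrow> 'a::ab_group_add \<Rightarrow> 'a) \<Rightarrow> ('a \<Rightarrow> 'a \<Rightarrow> 'a) \<Rightarrow> ('a \<Rightarrow> 'a \<Rightarrow> 'a) \<Rightarrow> nat \<Rightarrow>
     (nat \<Rightarrow> 'a list \<Rightarrow> 'a) set" where
  "compatible_cochains scale \<mu>1 \<mu>2 n =
     (if n = 0 then
        {F. F 1 \<in> cochains scale 0 \<and> (\<forall>i. i \<noteq> 1 \<longrightarrow> F i = 0) \<and>
            (\<forall>a. \<mu>1 a (F 1 []) - \<mu>1 (F 1 []) a = \<mu>2 a (F 1 []) - \<mu>2 (F 1 []) a)}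
      else
        {F. (\<forall>i\<in>{1..n}. F i \<in> cochains scale n) \<and> (\<forall>i. i \<notin> {1..n} \<longrightarrow> F i = 0)})"

text \<open>
  In degree \<open>0\<close> the Hochschild coboundary of \<open>m\<close> is \<open>a \<mapsto> a \<cdot>\<^sub>1 m - m \<cdot>\<^sub>1 a\<close>.
\<close>

definition compatible_coboundary ::
  "('k::field \<Rightarrow> 'a::ab_group_add \<Rightarrow> 'a) \<Rightarrow> ('a \<Rightarrow> 'a \<Rightarrow> 'a) \<Rightarrow> ('a \<Rightarrow> 'a \<Rightarrow> 'a) \<Rightarrow> nat \<Rightarrow>
     (nat \<Rightarrow> 'a list \<Rightarrow> 'a) \<Rightarrow> (nat \<Rightarrow> 'a list \<Rightarrow> 'a)" where
  "compatible_coboundary scale \<mu>1 \<mu>2 n F = (\<lambda>i.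
     if i = 1 then hochschild_coboundary scale \<mu>1 n (F 1)
     else if 2 \<le> i \<and> i \<le> n then
       hochschild_coboundary scale \<mu>1 n (F i) + hochschild_coboundary scale \<mu>2 n (F (i - 1))
     else if n \<ge> 1 \<and> i = n + 1 then hochschild_coboundary scale \<mu>2 n (F n)
     else 0)"

definition compatible_cocycles ::
  "('k::field \<Rightarrow> 'a::ab_group_add \<Rightarrow> 'a) \<Rightarrow> ('a \<Rightarrow> 'a \<Rightarrow> 'a) \<Rightarrow> ('a \<Rightarrow> 'a \<Rightarrow> 'a) \<Rightarrow> nat \<Rightarrow>
     (nat \<Rightarrow> 'a list \<Rightarrow> 'a) set" where
  "compatible_cocycles scale \<mu>1 \<mu>2 n =
     {F \<in> compatible_cochains scale \<mu>1 \<mu>2 n. compatible_coboundary scale \<mu>1 \<mu>2 n F = 0}"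

definition compatible_coboundaries ::
  "('k::field \<Rightarrow> 'a::ab_group_add \<Rightarrow> 'a) \<Rightarrow> ('a \<Rightarrow> 'a \<Rightarrow> 'a) \<Rightarrow> ('a \<Rightarrow> 'a \<Rightarrow> 'a) \<Rightarrow> nat \<Rightarrow>
     (nat \<Rightarrow> 'a list \<Rightarrow> 'a) set" where
  "compatible_coboundaries scale \<mu>1 \<mu>2 n =
     (if n = 0 then {0}
      else compatible_coboundary scale \<mu>1 \<mu>2 (n - 1) ` compatible_cochains scale \<mu>1 \<mu>2 (n - 1))"

text \<open>
  Cocycles modulo coboundaries, as a set of classes; its zero element is the class
  \<open>compatible_coboundaries scale \<mu>1 \<mu>2 n\<close>.
\<close>

definition compatible_cohomology ::
  "('k::field \<Rightarrow> 'a::ab_group_add \<Rightarrow> 'a) \<Rightarrow> ('a \<Rightarrow> 'a \<Rightarrow> 'a) \<Rightarrow> ('a \<Rightarrow> 'a \<Rightarrow> 'a) \<Rightarrow> nat \<Rightarrow>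
     (nat \<Rightarrow> 'a list \<Rightarrow> 'a) set set" where
  "compatible_cohomology scale \<mu>1 \<mu>2 n =
     compatible_cocycles scale \<mu>1 \<mu>2 n //
       {(F, G). F \<in> compatible_cocycles scale \<mu>1 \<mu>2 n \<and> G \<in> compatible_cocycles scale \<mu>1 \<mu>2 n \<and>
                F - G \<in> compatible_coboundaries scale \<mu>1 \<mu>2 n}"

section \<open>Finite order deformations\<close>

text \<open>
  \<open>K[[t]]/(t\<^sup>N\<^sup>+\<^sup>1)\<close> and \<open>A[[t]]/(t\<^sup>N\<^sup>+\<^sup>1)\<close>: a residue class is represented by its unique power
  series with no term of degree \<open>> N\<close>, and \<open>fps_cutoff (Suc N)\<close> is reduction to that
  representative.
\<close>

definition trunc_ring :: "nat \<Rightarrow> 'k::field fps ring" where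
  "trunc_ring N =
     \<lparr>carrier = {f. \<forall>n>N. fps_nth f n = 0}, monoid.mult = (\<lambda>f g. fps_cutoff (Suc N) (f * g)),
      one = 1, zero = 0, add = (+)\<rparr>"

definition trunc_module ::
  "('k::field \<Rightarrow> 'a::ab_group_add \<Rightarrow> 'a) \<Rightarrow> nat \<Rightarrow> ('k fps, 'a fps) module" where
  "trunc_module scale N =
     \<lparr>carrier = {x. \<forall>n>N. fps_nth x n = 0}, monoid.mult = undefined, one = undefined,
      zero = 0, add = (+),
      smult = (\<lambda>f x. fps_cutoff (Suc N)
        (Abs_fps (\<lambda>n. \<Sum>i\<le>n. scale (fps_nth f i) (fps_nth x (n - i)))))\<rparr>"

text \<open>
  The product given by \<open>\<Sum>\<^sub>i t\<^sup>i \<mu> i\<close> on \<open>A[[t]]/(t\<^sup>N\<^sup>+\<^sup>1)\<close>: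
  \<open>(\<Sum>\<^sub>j t\<^sup>j x\<^sub>j, \<Sum>\<^sub>k t\<^sup>k y\<^sub>k) \<mapsto> \<Sum>\<^sub>i\<^sub>,\<^sub>j\<^sub>,\<^sub>k t\<^sup>i\<^sup>+\<^sup>j\<^sup>+\<^sup>k \<mu> i x\<^sub>j y\<^sub>k\<close>.
\<close>

definition trunc_product ::
  "nat \<Rightarrow> (nat \<Rightarrow> 'a \<Rightarrow> 'a \<Rightarrow> 'a) \<Rightarrow> 'a::ab_group_add fps \<Rightarrow> 'a fps \<Rightarrow> 'a fps" where
  "trunc_product N \<mu> x y = fps_cutoff (Suc N)
     (Abs_fps (\<lambda>n. \<Sum>i\<le>n. \<Sum>j\<le>n - i. \<mu> i (fps_nth x j) (fps_nth y (n - i - j))))"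

text \<open>
  A polynomial \<open>\<Sum>\<^sub>i\<^sub>\<le>\<^sub>N t\<^sup>i m i\<close> with bilinear coefficients is the family \<open>m\<close> of its coefficients,
  zero beyond \<open>N\<close>.
\<close>

definition finite_order_deformation ::
  "('k::field \<Rightarrow> 'a::ab_group_add \<Rightarrow> 'a) \<Rightarrow> ('a \<Rightarrow> 'a \<Rightarrow> 'a) \<Rightarrow> ('a \<Rightarrow> 'a \<Rightarrow> 'a) \<Rightarrow> nat \<Rightarrow>
     (nat \<Rightarrow> 'a \<Rightarrow> 'a \<Rightarrow> 'a) \<Rightarrow> (nat \<Rightarrow> 'a \<Rightarrow> 'a \<Rightarrow> 'a) \<Rightarrow> bool" where
  "finite_order_deformation scale \<mu>1 \<mu>2 N m1 m2 \<longleftrightarrow>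
     N \<ge> 1 \<and>
     (\<forall>i\<le>N. bilinear_product scalar_ring (scalar_module scale) (m1 i) \<and>
            bilinear_product scalar_ring (scalar_module scale) (m2 i)) \<and>
     (\<forall>i>N. m1 i = 0 \<and> m2 i = 0) \<and>
     m1 0 = \<mu>1 \<and> m2 0 = \<mu>2 \<and>
     compatible_associative_algebra (trunc_ring N) (trunc_module scale N)
       (trunc_product N m1) (trunc_product N m2)"

definition extensible ::
  "('k::field \<Rightarrow> 'a::ab_group_add \<Rightarrow> 'a) \<Rightarrow> ('a \<Rightarrow> 'a \<Rightarrow> 'a) \<Rightarrow> ('a \<Rightarrow> 'a \<Rightarrow> 'a) \<Rightarrow> nat \<Rightarrow>
     (nat \<Rightarrow> 'a \<Rightarrow> 'a \<Rightarrow> 'a) \<Rightarrow> (nat \<Rightarrow> 'a \<Rightarrow> 'a \<Rightarrow> 'a) \<Rightarrow> bool" where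
  "extensible scale \<mu>1 \<mu>2 N m1 m2 \<longleftrightarrow>
     (\<exists>\<nu>1 \<nu>2.
        bilinear_product scalar_ring (scalar_module scale) \<nu>1 \<and>
        bilinear_product scalar_ring (scalar_module scale) \<nu>2 \<and>
        finite_order_deformation scale \<mu>1 \<mu>2 (Suc N) (m1(Suc N := \<nu>1)) (m2(Suc N := \<nu>2)))"

end

theory Submission
  imports Defs
begin

text \<open>
  Write \<open>[p, q](a, b, c) = p (q a b) c - p a (q b c)\<close> for bilinear products \<open>p\<close>, \<open>q\<close>. For families
  of coefficients \<open>p\<close>, \<open>q\<close> let \<open>A\<^sub>n(p, q)\<close> be the sum of \<open>[p\<^sub>i, q\<^sub>j]\<close> over \<open>i + j = n\<close>. Both associativity
  laws and the compatibility law of the truncated products are trilinear over the truncated power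
  series, so they can be read off from their coefficients on constant series: the pair \<open>(m1, m2)\<close> is
  a deformation of order \<open>N\<close> exactly if
  \<open>A\<^sub>n(m1, m1) = 0, A\<^sub>n(m1, m2) + A\<^sub>n(m2, m1) = 0, A\<^sub>n(m2, m2) = 0\<close>
  for all \<open>n \<le> N\<close> (\<open>compatible_trunc_iff\<close>).

  Adding top coefficients \<open>\<nu>1\<close>, \<open>\<nu>2\<close> leaves the equations of degree \<open>\<le> N\<close> alone. In degree \<open>N + 1\<close> it
  subtracts \<open>\<delta>\<^sub>1 \<nu>1\<close>, \<open>\<delta>\<^sub>1 \<nu>2 + \<delta>\<^sub>2 \<nu>1\<close> and \<open>\<delta>\<^sub>2 \<nu>2\<close> from the three left-hand sides. Hence an extension
  exists exactly if the obstruction \<open>\<Theta>\<close>, the triple of left-hand sides in degree \<open>N + 1\<close>, is the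
  compatible coboundary of a 2-cochain. As the third cohomology vanishes, it is enough that
  \<open>\<Theta>\<close> is a cocycle (\<open>obstruction_cocycle\<close>).

  That \<open>\<Theta>\<close> is a cocycle comes from the pentagon identity
  \<open>a [b, c, d] - [a b, c, d] + [a, b c, d] - [a, b, c d] + [a, b, c] d = 0\<close>
  for the associator of any bilinear product whatsoever. For the product
  \<open>\<Sum>\<^sub>i t\<^sup>i (m1\<^sub>i + s m2\<^sub>i)\<close> with two formal parameters, the coefficient of \<open>t\<^sup>N\<^sup>+\<^sup>1\<close> involves only
  \<open>m1\<^sub>0 + s m2\<^sub>0\<close> and the associator in degree \<open>N + 1\<close>, all lower ones being zero; its four
  coefficients in \<open>s\<close> are the components of \<open>\<delta>\<^sub>c \<Theta> = 0\<close>. The parameter \<open>s\<close> is avoided by polarising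
  the identity over three families of products (\<open>graded_pentagon_trees\<close>).
\<close>

section \<open>Biadditive maps\<close>

definition biadditive :: "('a::ab_group_add \<Rightarrow> 'b::ab_group_add \<Rightarrow> 'c::ab_group_add) \<Rightarrow> bool" where
  "biadditive p \<longleftrightarrow> (\<forall>x. additive (p x)) \<and> (\<forall>y. additive (\<lambda>x. p x y))"

lemma biadditiveI:
  assumes "\<And>x x' y. p (x + x') y = p x y + p x' y" and "\<And>x y y'. p x (y + y') = p x y + p x y'"
  shows "biadditive p"
  using assms by (simp add: biadditive_def additive_def)

lemma
  assumes "biadditive p"
  shows biadditive_add_left: "p (x + x') y = p x y + p x' y"
    and biadditive_add_right: "p x (y + y') = p x y + p x y'"
    and biadditive_diff_left: "p (x - x') y = p x y - p x' y"
    and biadditive_diff_right: "p x (y - y') = p x y - p x y'"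
    and biadditive_zero_left: "p 0 y = 0"
    and biadditive_zero_right: "p x 0 = 0"
    and biadditive_sum_left: "p (sum f S) y = (\<Sum>s\<in>S. p (f s) y)"
    and biadditive_sum_right: "p x (sum g T) = (\<Sum>s\<in>T. p x (g s))"
proof -
  interpret l: additive "\<lambda>x. p x y" using assms by (simp add: biadditive_def)
  interpret r: additive "p x" using assms by (simp add: biadditive_def)
  show "p (x + x') y = p x y + p x' y" by (rule l.add)
  show "p x (y + y') = p x y + p x y'" by (rule r.add)
  show "p (x - x') y = p x y - p x' y" by (rule l.diff)
  show "p x (y - y') = p x y - p x y'" by (rule r.diff)
  show "p 0 y = 0" by (rule l.zero)
  show "p x 0 = 0" by (rule r.zero)
  show "p (sum f S) y = (\<Sum>s\<in>S. p (f s) y)" by (rule l.sum)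
  show "p x (sum g T) = (\<Sum>s\<in>T. p x (g s))" by (rule r.sum)
qed

lemmas biadditive_simps =
  biadditive_add_left biadditive_add_right biadditive_diff_left biadditive_diff_right
  biadditive_zero_left biadditive_zero_right

lemma biadditive_zero: "biadditive (\<lambda>x y. 0)"
  by (rule biadditiveI) simp_all

section \<open>Products of power series with graded coefficients\<close>

definition tuples3 :: "nat \<Rightarrow> (nat \<times> nat \<times> nat) set" where
  "tuples3 n = {(i, j, k). i + j + k = n}"

definition tuples4 :: "nat \<Rightarrow> (nat \<times> nat \<times> nat \<times> nat) set" where
  "tuples4 n = {(i, j, k, l). i + j + k + l = n}"

definition tuples5 :: "nat \<Rightarrow> (nat \<times> nat \<times> nat \<times> nat \<times> nat) set" where
  "tuples5 n = {(i, j, u, v, w). i + j + u + v + w = n}"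

lemma finite_tuples3 [simp, intro]: "finite (tuples3 n)"
  by (rule finite_subset[of _ "{..n} \<times> {..n} \<times> {..n}"]) (auto simp: tuples3_def)

lemma finite_tuples4 [simp, intro]: "finite (tuples4 n)"
  by (rule finite_subset[of _ "{..n} \<times> {..n} \<times> {..n} \<times> {..n}"]) (auto simp: tuples4_def)

lemma sum_over_Sigma:
  assumes "finite A" "\<And>a. finite (B a)"
  shows "sum h (Sigma A B) = (\<Sum>a\<in>A. \<Sum>b\<in>B a. h (a, b))"
  using sum.Sigma[of A B "\<lambda>a b. h (a, b)"] assms by simp

lemma sum_tuples3: "(\<Sum>i\<le>n. \<Sum>j\<le>n - i. f i j (n - i - j)) = (\<Sum>(i, j, k)\<in>tuples3 n. f i j k)"
proof -
  have "(\<Sum>i\<le>n. \<Sum>j\<le>n - i. f i j (n - i - j))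
      = (\<Sum>(i, j)\<in>(SIGMA i:{..n}. {..n - i}). f i j (n - i - j))"
    by (simp add: sum.Sigma)
  also have "\<dots> = (\<Sum>(i, j, k)\<in>tuples3 n. f i j k)"
    by (rule sum.reindex_bij_witness[of _ "\<lambda>(i, j, k). (i, j)" "\<lambda>(i, j). (i, j, n - i - j)"])
      (auto simp: tuples3_def)
  finally show ?thesis .
qed

text \<open>
  The coefficients may map between different groups. Thus multiplication of scalar series, their
  action on vector series and deformed products are instances of one operation, and all associative
  laws between them come from the same two expansions as sums over 5-tuples.
\<close>

definition graded_product ::
  "(nat \<Rightarrow> 'a::ab_group_add \<Rightarrow> 'b::ab_group_add \<Rightarrow> 'c::ab_group_add) \<Rightarrow> 'a fps \<Rightarrow> 'b fps \<Rightarrow> 'c fps" where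
  "graded_product m x y =
     Abs_fps (\<lambda>n. \<Sum>i\<le>n. \<Sum>j\<le>n - i. m i (fps_nth x j) (fps_nth y (n - i - j)))"

lemma graded_product_nth:
  "fps_nth (graded_product m x y) n =
     (\<Sum>(i, j, k)\<in>tuples3 n. m i (fps_nth x j) (fps_nth y k))"
  unfolding graded_product_def fps_nth_Abs_fps
  by (rule sum_tuples3[where f = "\<lambda>i j k. m i (fps_nth x j) (fps_nth y k)"])

lemma graded_product_add:
  assumes "\<And>i. biadditive (m i)"
  shows "graded_product m (x + x') y = graded_product m x y + graded_product m x' y"
    and "graded_product m x (y + y') = graded_product m x y + graded_product m x y'"
  using assms
  by (auto intro!: fps_ext simp: graded_product_nth biadditive_simps sum.distrib split_def)

text \<open>
  In both bracketings of a double product the indices are ordered as: degree of \<open>p\<close>, degree of \<open>q\<close>,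
  degrees of the arguments. The summands of the two can then be compared index by index.
\<close>

lemma graded_product_assoc_left_nth:
  assumes "\<And>i. biadditive (p i)"
  shows "fps_nth (graded_product p (graded_product q x y) z) n =
    (\<Sum>(i, j, u, v, w)\<in>tuples5 n. p i (q j (fps_nth x u) (fps_nth y v)) (fps_nth z w))"
proof -
  have "fps_nth (graded_product p (graded_product q x y) z) n =
     (\<Sum>(s, t)\<in>(SIGMA s:tuples3 n. tuples3 (fst (snd s))).
        case s of (i, l, w) \<Rightarrow> case t of (j, u, v) \<Rightarrow>
          p i (q j (fps_nth x u) (fps_nth y v)) (fps_nth z w))"
    by (simp add: graded_product_nth biadditive_sum_left[OF assms] sum_over_Sigma split_def)
  also have "\<dots> =
    (\<Sum>(i, j, u, v, w)\<in>tuples5 n. p i (q j (fps_nth x u) (fps_nth y v)) (fps_nth z w))"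
    by (rule sum.reindex_bij_witness[of _ "\<lambda>(i, j, u, v, w). ((i, j + u + v, w), (j, u, v))"
          "\<lambda>((i, l, w), (j, u, v)). (i, j, u, v, w)"])
      (auto simp: tuples3_def tuples5_def)
  finally show ?thesis .
qed

lemma graded_product_assoc_right_nth:
  assumes "\<And>i. biadditive (p i)"
  shows "fps_nth (graded_product p x (graded_product q y z)) n =
    (\<Sum>(i, j, u, v, w)\<in>tuples5 n. p i (fps_nth x u) (q j (fps_nth y v) (fps_nth z w)))"
proof -
  have "fps_nth (graded_product p x (graded_product q y z)) n =
     (\<Sum>(s, t)\<in>(SIGMA s:tuples3 n. tuples3 (snd (snd s))).
        case s of (i, u, l) \<Rightarrow> case t of (j, v, w) \<Rightarrow>
          p i (fps_nth x u) (q j (fps_nth y v) (fps_nth z w)))"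
    by (simp add: graded_product_nth biadditive_sum_right[OF assms] sum_over_Sigma split_def)
  also have "\<dots> =
    (\<Sum>(i, j, u, v, w)\<in>tuples5 n. p i (fps_nth x u) (q j (fps_nth y v) (fps_nth z w)))"
    by (rule sum.reindex_bij_witness[of _ "\<lambda>(i, j, u, v, w). ((i, u, j + v + w), (j, v, w))"
          "\<lambda>((i, u, l), (j, v, w)). (i, j, u, v, w)"])
      (auto simp: tuples3_def tuples5_def)
  finally show ?thesis .
qed

text \<open>
  A map regarded as a family living in degree 0, so that scalar multiplication and the product of
  scalar series become graded products.
\<close>

definition concentrated :: "('a \<Rightarrow> 'b \<Rightarrow> 'c::zero) \<Rightarrow> nat \<Rightarrow> 'a \<Rightarrow> 'b \<Rightarrow> 'c" where
  "concentrated b i = (if i = 0 then b else (\<lambda>x y. 0))"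

lemma biadditive_concentrated: "biadditive b \<Longrightarrow> biadditive (concentrated b i)"
  by (simp add: concentrated_def biadditive_zero)

lemma graded_product_concentrated:
  "graded_product (concentrated b) x y = Abs_fps (\<lambda>n. \<Sum>j\<le>n. b (fps_nth x j) (fps_nth y (n - j)))"
proof (rule fps_ext)
  fix n
  have "fps_nth (graded_product (concentrated b) x y) n =
      (\<Sum>i\<in>{..n}. if i = 0 then (\<Sum>j\<le>n. b (fps_nth x j) (fps_nth y (n - j))) else 0)"
    unfolding graded_product_def fps_nth_Abs_fps
    by (rule sum.cong) (auto simp: concentrated_def)
  then show "fps_nth (graded_product (concentrated b) x y) n =
      fps_nth (Abs_fps (\<lambda>n. \<Sum>j\<le>n. b (fps_nth x j) (fps_nth y (n - j)))) n"
    by simp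
qed

lemma graded_product_mult:
  "graded_product (concentrated (*)) f g = (f * g :: 'k::comm_ring_1 fps)"
  by (simp add: graded_product_concentrated fps_eq_iff fps_mult_nth atLeast0AtMost)

section \<open>Associators in each degree\<close>

definition graded_associator ::
  "(nat \<Rightarrow> 'a::ab_group_add \<Rightarrow> 'a \<Rightarrow> 'a) \<Rightarrow> (nat \<Rightarrow> 'a \<Rightarrow> 'a \<Rightarrow> 'a) \<Rightarrow> nat \<Rightarrow> 'a \<Rightarrow> 'a \<Rightarrow> 'a \<Rightarrow> 'a" where
  "graded_associator p q n a b c = (\<Sum>i\<le>n. p i (q (n - i) a b) c - p i a (q (n - i) b c))"

text \<open>
  Collecting the 5-tuples by the total degree of the two products shows that the associator of series
  is determined by the graded associators on elements of the algebra.
\<close>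

lemma graded_associator_nth:
  assumes "\<And>i. biadditive (p i)"
  shows "fps_nth (graded_product p (graded_product q x y) z
            - graded_product p x (graded_product q y z)) n =
    (\<Sum>(s, u, v, w)\<in>tuples4 n. graded_associator p q s (fps_nth x u) (fps_nth y v) (fps_nth z w))"
proof -
  have "fps_nth (graded_product p (graded_product q x y) z
            - graded_product p x (graded_product q y z)) n =
      (\<Sum>(i, j, u, v, w)\<in>tuples5 n. p i (q j (fps_nth x u) (fps_nth y v)) (fps_nth z w)
          - p i (fps_nth x u) (q j (fps_nth y v) (fps_nth z w)))"
    by (simp add: graded_product_assoc_left_nth[OF assms]
        graded_product_assoc_right_nth[OF assms] sum_subtractf split_def)
  also have "\<dots> = (\<Sum>((s, u, v, w), i)\<in>(SIGMA t:tuples4 n. {..fst t}).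
       p i (q (s - i) (fps_nth x u) (fps_nth y v)) (fps_nth z w)
          - p i (fps_nth x u) (q (s - i) (fps_nth y v) (fps_nth z w)))"
    by (rule sum.reindex_bij_witness[of _ "\<lambda>((s, u, v, w), i). (i, s - i, u, v, w)"
          "\<lambda>(i, j, u, v, w). ((i + j, u, v, w), i)"])
      (auto simp: tuples4_def tuples5_def)
  also have "\<dots> = (\<Sum>(s, u, v, w)\<in>tuples4 n.
      graded_associator p q s (fps_nth x u) (fps_nth y v) (fps_nth z w))"
    by (simp add: graded_associator_def sum_over_Sigma split_def)
  finally show ?thesis .
qed

definition deformation_equations ::
  "(nat \<Rightarrow> 'a::ab_group_add \<Rightarrow> 'a \<Rightarrow> 'a) \<Rightarrow> (nat \<Rightarrow> 'a \<Rightarrow> 'a \<Rightarrow> 'a) \<Rightarrow> nat \<Rightarrow> bool" where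
  "deformation_equations m1 m2 n \<longleftrightarrow>
     (\<forall>a b c. graded_associator m1 m1 n a b c = 0 \<and> graded_associator m2 m2 n a b c = 0 \<and>
        graded_associator m1 m2 n a b c + graded_associator m2 m1 n a b c = 0)"

lemma graded_associator_zero:
  assumes "\<And>i. biadditive (p i)" "\<And>i. biadditive (q i)"
  shows "graded_associator p q n 0 b c = 0" "graded_associator p q n a 0 c = 0"
    "graded_associator p q n a b 0 = 0"
  by (simp_all add: graded_associator_def biadditive_zero_left[OF assms(1)]
      biadditive_zero_left[OF assms(2)] biadditive_zero_right[OF assms(1)]
      biadditive_zero_right[OF assms(2)])

lemma graded_associator_nth_const:
  assumes "\<And>i. biadditive (p i)" "\<And>i. biadditive (q i)"
  shows "fps_nth (graded_product p (graded_product q (fps_const a) (fps_const b)) (fps_const c)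
            - graded_product p (fps_const a) (graded_product q (fps_const b) (fps_const c))) n =
         graded_associator p q n a b c"
proof -
  have "(\<Sum>(s, u, v, w)\<in>tuples4 n. graded_associator p q s
          (fps_nth (fps_const a) u) (fps_nth (fps_const b) v) (fps_nth (fps_const c) w)) =
        (\<Sum>(s, u, v, w)\<in>{(n, 0, 0, 0)}. graded_associator p q s
          (fps_nth (fps_const a) u) (fps_nth (fps_const b) v) (fps_nth (fps_const c) w))"
    by (rule sum.mono_neutral_right, simp, simp add: tuples4_def)
      (auto simp: tuples4_def graded_associator_zero[OF assms] split: if_splits)
  then show ?thesis unfolding graded_associator_nth[OF assms(1)] by simp
qed

section \<open>Truncation\<close>

text \<open>
  A coefficient of a product depends only on coefficients of at most the same degree, so nested
  truncations can be dropped.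
\<close>

lemma graded_product_cutoff:
  "fps_cutoff n (graded_product m (fps_cutoff n x) y) = fps_cutoff n (graded_product m x y)"
  "fps_cutoff n (graded_product m x (fps_cutoff n y)) = fps_cutoff n (graded_product m x y)"
  by (auto intro!: fps_ext sum.cong simp: graded_product_def) arith

lemma fps_mult_cutoff:
  fixes f g :: "'k::comm_ring_1 fps"
  shows "fps_cutoff n (fps_cutoff n f * g) = fps_cutoff n (f * g)"
    and "fps_cutoff n (f * fps_cutoff n g) = fps_cutoff n (f * g)"
  using graded_product_cutoff[of n "concentrated (*)" f g] by (simp_all add: graded_product_mult)

lemma fps_cutoff_idem:
  "(\<forall>i>N. fps_nth x i = 0) \<Longrightarrow> fps_cutoff (Suc N) x = x"
  by (auto intro!: fps_ext)

lemma cring_trunc_ring: "cring (trunc_ring N :: 'k::field fps ring)"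
proof (rule cringI)
  show "abelian_group (trunc_ring N :: 'k fps ring)"
  proof (rule abelian_groupI)
    show "\<exists>y\<in>carrier (trunc_ring N). y \<oplus>\<^bsub>trunc_ring N\<^esub> x = \<zero>\<^bsub>trunc_ring N\<^esub>"
      if "x \<in> carrier (trunc_ring N)" for x :: "'k fps"
      using that by (intro bexI[of _ "- x"]) (auto simp: trunc_ring_def)
  qed (auto simp: trunc_ring_def)
  show "comm_monoid (trunc_ring N :: 'k fps ring)"
    by (rule comm_monoidI)
      (auto simp: trunc_ring_def fps_mult_cutoff fps_cutoff_idem ac_simps)
qed (auto simp: trunc_ring_def distrib_right fps_cutoff_add)

lemma trunc_product_eq: "trunc_product N m x y = fps_cutoff (Suc N) (graded_product m x y)"
  by (simp add: trunc_product_def graded_product_def)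

lemma trunc_smult_eq:
  "f \<odot>\<^bsub>trunc_module scale N\<^esub> x = fps_cutoff (Suc N) (graded_product (concentrated scale) f x)"
  by (simp add: trunc_module_def graded_product_concentrated)

abbreviation bilinear_over ::
  "('k::field \<Rightarrow> 'a::ab_group_add \<Rightarrow> 'a) \<Rightarrow> ('a \<Rightarrow> 'a \<Rightarrow> 'a) \<Rightarrow> bool" where
  "bilinear_over scale \<equiv> bilinear_product scalar_ring (scalar_module scale)"

context vector_space
begin

lemma biadditive_scale: "biadditive scale"
  by (rule biadditiveI) (simp_all add: algebra_simps)

lemma module_trunc_module: "Module.module (trunc_ring N) (trunc_module scale N)"
proof (rule Module.moduleI)
  show "cring (trunc_ring N :: 'a fps ring)" by (rule cring_trunc_ring)
  show "abelian_group (trunc_module scale N)"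
  proof (rule abelian_groupI)
    show "\<exists>y\<in>carrier (trunc_module scale N). y \<oplus>\<^bsub>trunc_module scale N\<^esub> x = \<zero>\<^bsub>trunc_module scale N\<^esub>"
      if "x \<in> carrier (trunc_module scale N)" for x
      using that by (intro bexI[of _ "- x"]) (auto simp: trunc_module_def)
  qed (auto simp: trunc_module_def)
  let ?s = "graded_product (concentrated scale)"
  note bi = biadditive_concentrated[OF biadditive_scale]
  show "(f \<oplus>\<^bsub>trunc_ring N\<^esub> g) \<odot>\<^bsub>trunc_module scale N\<^esub> x =
      f \<odot>\<^bsub>trunc_module scale N\<^esub> x \<oplus>\<^bsub>trunc_module scale N\<^esub> g \<odot>\<^bsub>trunc_module scale N\<^esub> x" for f g x
    unfolding trunc_smult_eq
    by (simp add: trunc_ring_def trunc_module_def graded_product_add[OF bi] fps_cutoff_add)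
  show "f \<odot>\<^bsub>trunc_module scale N\<^esub> (x \<oplus>\<^bsub>trunc_module scale N\<^esub> y) =
      f \<odot>\<^bsub>trunc_module scale N\<^esub> x \<oplus>\<^bsub>trunc_module scale N\<^esub> f \<odot>\<^bsub>trunc_module scale N\<^esub> y" for f x y
    unfolding trunc_smult_eq
    by (simp add: trunc_module_def graded_product_add[OF bi] fps_cutoff_add)
  have "?s (f * g) x = ?s f (?s g x)" for f g x
    unfolding graded_product_mult[symmetric]
    by (rule fps_ext, unfold graded_product_assoc_left_nth[OF bi]
        graded_product_assoc_right_nth[OF bi], rule sum.cong)
      (auto simp: concentrated_def)
  then show "(f \<otimes>\<^bsub>trunc_ring N\<^esub> g) \<odot>\<^bsub>trunc_module scale N\<^esub> x =
      f \<odot>\<^bsub>trunc_module scale N\<^esub> (g \<odot>\<^bsub>trunc_module scale N\<^esub> x)" for f g x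
    unfolding trunc_smult_eq by (simp add: trunc_ring_def graded_product_cutoff)
  show "\<one>\<^bsub>trunc_ring N\<^esub> \<odot>\<^bsub>trunc_module scale N\<^esub> x = x"
    if "x \<in> carrier (trunc_module scale N)" for x
  proof -
    have "?s 1 x = x"
      by (rule fps_ext) (simp add: graded_product_concentrated if_distribR
          if_distrib[where f = "\<lambda>c. scale c _"] cong: if_cong)
    then show ?thesis
      unfolding trunc_smult_eq using that
      by (simp add: trunc_ring_def trunc_module_def fps_cutoff_idem)
  qed
qed (auto simp: trunc_ring_def trunc_module_def)

lemma bilinear_iff:
  "bilinear_over scale p \<longleftrightarrow>
     biadditive p \<and> (\<forall>r x y. p (r *s x) y = r *s p x y \<and> p x (r *s y) = r *s p x y)"
  by (auto simp: bilinear_product_def scalar_ring_def scalar_module_def biadditive_simps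
      intro!: biadditiveI)

lemma bilinear_zero: "bilinear_over scale 0"
  by (simp add: bilinear_iff biadditiveI)

lemma bilinear_product_trunc_product:
  assumes m: "\<And>i. bilinear_over scale (m i)"
  shows "bilinear_product (trunc_ring N) (trunc_module scale N) (trunc_product N m)"
proof -
  have bm: "biadditive (m i)" for i using m by (simp add: bilinear_iff)
  note bi = biadditive_concentrated[OF biadditive_scale]
  let ?s = "graded_product (concentrated scale)"
  \<comment> \<open>Scalars multiply out of each \<open>m i\<close>; on the index tuples this exchanges the degrees of the two
    products, and for the second argument also those of the scalar and of the first argument.\<close>
  have l: "graded_product m (?s f x) y = ?s f (graded_product m x y)" for f x y
  proof (rule fps_ext)
    fix n
    show "fps_nth (graded_product m (?s f x) y) n = fps_nth (?s f (graded_product m x y)) n"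
      unfolding graded_product_assoc_left_nth[OF bm] graded_product_assoc_right_nth[OF bi]
      by (rule sum.reindex_bij_witness[of _ "\<lambda>(i, j, t). (j, i, t)" "\<lambda>(i, j, t). (j, i, t)"])
        (use m in \<open>auto simp: tuples5_def concentrated_def bilinear_iff
            biadditive_simps\<close>)
  qed
  have r: "graded_product m x (?s f y) = ?s f (graded_product m x y)" for f x y
  proof (rule fps_ext)
    fix n
    show "fps_nth (graded_product m x (?s f y)) n = fps_nth (?s f (graded_product m x y)) n"
      unfolding graded_product_assoc_right_nth[OF bm] graded_product_assoc_right_nth[OF bi]
      by (rule sum.reindex_bij_witness[of _ "\<lambda>(i, j, u, v, w). (j, i, v, u, w)"
            "\<lambda>(i, j, u, v, w). (j, i, v, u, w)"])
        (use m in \<open>auto simp: tuples5_def concentrated_def bilinear_iff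
            biadditive_simps\<close>)
  qed
  have "trunc_product N m x y \<in> carrier (trunc_module scale N)" for x y
    by (simp add: trunc_product_eq trunc_module_def)
  moreover have "trunc_product N m (x \<oplus>\<^bsub>trunc_module scale N\<^esub> y) z =
      trunc_product N m x z \<oplus>\<^bsub>trunc_module scale N\<^esub> trunc_product N m y z"
    "trunc_product N m z (x \<oplus>\<^bsub>trunc_module scale N\<^esub> y) =
      trunc_product N m z x \<oplus>\<^bsub>trunc_module scale N\<^esub> trunc_product N m z y" for x y z
    by (simp_all add: trunc_product_eq trunc_module_def graded_product_add[OF bm] fps_cutoff_add)
  moreover have "trunc_product N m (f \<odot>\<^bsub>trunc_module scale N\<^esub> x) y =
      f \<odot>\<^bsub>trunc_module scale N\<^esub> trunc_product N m x y"
    "trunc_product N m x (f \<odot>\<^bsub>trunc_module scale N\<^esub> y) =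
      f \<odot>\<^bsub>trunc_module scale N\<^esub> trunc_product N m x y" for f x y
    by (simp_all add: trunc_product_eq trunc_smult_eq graded_product_cutoff l r)
  ultimately show ?thesis by (simp add: bilinear_product_def)
qed

text \<open>
  Constant series recover the equations from the laws; conversely a coefficient of degree \<open>\<le> N\<close> of an
  associator of series uses only graded associators of degree \<open>\<le> N\<close>. The module and bilinearity
  axioms over the truncated series hold for every family of bilinear coefficients.
\<close>

lemma compatible_trunc_iff:
  assumes m1: "\<And>i. bilinear_over scale (m1 i)"
    and m2: "\<And>i. bilinear_over scale (m2 i)"
  shows "compatible_associative_algebra (trunc_ring N) (trunc_module scale N)
       (trunc_product N m1) (trunc_product N m2) \<longleftrightarrow>
     (\<forall>n\<le>N. deformation_equations m1 m2 n)"
    (is "?L \<longleftrightarrow> ?R")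
proof -
  have b: "biadditive (m1 i)" "biadditive (m2 i)" for i
    using m1 m2 by (simp_all add: bilinear_iff)
  let ?C = "carrier (trunc_module scale N)"
  define A where "A p q x y z = graded_product p (graded_product q x y) z
            - graded_product p x (graded_product q y z)"
    for p q :: "nat \<Rightarrow> 'b \<Rightarrow> 'b \<Rightarrow> 'b" and x y z
  have "?L \<longleftrightarrow> (\<forall>x\<in>?C. \<forall>y\<in>?C. \<forall>z\<in>?C. \<forall>n\<le>N.
      fps_nth (A m1 m1 x y z) n = 0 \<and> fps_nth (A m2 m2 x y z) n = 0 \<and>
      fps_nth (A m1 m2 x y z) n + fps_nth (A m2 m1 x y z) n = 0)"
    unfolding compatible_associative_algebra_def A_def
    by (simp add: module_trunc_module bilinear_product_trunc_product m1 m2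
        trunc_product_eq graded_product_cutoff)
      (auto simp: fps_eq_iff trunc_module_def less_Suc_eq_le algebra_simps)
  also have "\<dots> \<longleftrightarrow> ?R"
    unfolding deformation_equations_def
  proof safe
    fix n a b c
    assume *: "\<forall>x\<in>?C. \<forall>y\<in>?C. \<forall>z\<in>?C. \<forall>n\<le>N.
      fps_nth (A m1 m1 x y z) n = 0 \<and> fps_nth (A m2 m2 x y z) n = 0 \<and>
      fps_nth (A m1 m2 x y z) n + fps_nth (A m2 m1 x y z) n = 0" and "n \<le> N"
    have "fps_const a \<in> ?C" for a by (simp add: trunc_module_def)
    with * \<open>n \<le> N\<close> have "fps_nth (A m1 m1 (fps_const a) (fps_const b) (fps_const c)) n = 0 \<and>
      fps_nth (A m2 m2 (fps_const a) (fps_const b) (fps_const c)) n = 0 \<and>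
      fps_nth (A m1 m2 (fps_const a) (fps_const b) (fps_const c)) n
      + fps_nth (A m2 m1 (fps_const a) (fps_const b) (fps_const c)) n = 0" by blast
    then show "graded_associator m1 m1 n a b c = 0" "graded_associator m2 m2 n a b c = 0"
      "graded_associator m1 m2 n a b c + graded_associator m2 m1 n a b c = 0"
      unfolding A_def using b by (simp_all only: graded_associator_nth_const)
  next
    fix x y z n
    assume R: "\<forall>n\<le>N. \<forall>a b c. graded_associator m1 m1 n a b c = 0 \<and>
        graded_associator m2 m2 n a b c = 0 \<and>
        graded_associator m1 m2 n a b c + graded_associator m2 m1 n a b c = 0" and "n \<le> N"
    then have s: "s \<le> N" if "(s, u, v, w) \<in> tuples4 n" for s u v w
      using that by (auto simp: tuples4_def)
    show "fps_nth (A m1 m1 x y z) n = 0" "fps_nth (A m2 m2 x y z) n = 0"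
      unfolding A_def graded_associator_nth[OF b(1)] graded_associator_nth[OF b(2)]
      using R s by (auto intro!: sum.neutral)
    show "fps_nth (A m1 m2 x y z) n + fps_nth (A m2 m1 x y z) n = 0"
      unfolding A_def graded_associator_nth[OF b(1)] graded_associator_nth[OF b(2)]
        sum.distrib[symmetric]
      using R s by (auto intro!: sum.neutral)
  qed
  finally show ?thesis .
qed

end

section \<open>The pentagon identity\<close>

definition coboundary3 ::
  "('a::ab_group_add \<Rightarrow> 'a \<Rightarrow> 'a) \<Rightarrow> ('a \<Rightarrow> 'a \<Rightarrow> 'a \<Rightarrow> 'a) \<Rightarrow> 'a \<Rightarrow> 'a \<Rightarrow> 'a \<Rightarrow> 'a \<Rightarrow> 'a" where
  "coboundary3 \<mu> f a b c d =
     \<mu> a (f b c d) - f (\<mu> a b) c d + f a (\<mu> b c) d - f a b (\<mu> c d) + \<mu> (f a b c) d"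

lemma coboundary3_sum:
  assumes "biadditive \<mu>"
  shows "coboundary3 \<mu> (\<lambda>x y z. \<Sum>j\<in>S. f j x y z) a b c d = (\<Sum>j\<in>S. coboundary3 \<mu> (f j) a b c d)"
  by (simp add: coboundary3_def biadditive_sum_left[OF assms] biadditive_sum_right[OF assms]
      sum.distrib sum_subtractf)

lemma coboundary3_add:
  assumes "biadditive \<mu>"
  shows "coboundary3 \<mu> (\<lambda>x y z. f x y z + g x y z) a b c d =
    coboundary3 \<mu> f a b c d + coboundary3 \<mu> g a b c d"
  by (simp add: coboundary3_def biadditive_simps[OF assms])

lemma coboundary3_zero:
  assumes "biadditive \<mu>"
  shows "coboundary3 \<mu> (\<lambda>x y z. 0) a b c d = 0"
  by (simp add: coboundary3_def biadditive_simps[OF assms])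

definition graded_sum3 ::
  "('p \<Rightarrow> 'p \<Rightarrow> 'p \<Rightarrow> 'a::ab_group_add) \<Rightarrow> nat \<Rightarrow> (nat \<Rightarrow> 'p) \<Rightarrow> (nat \<Rightarrow> 'p) \<Rightarrow> (nat \<Rightarrow> 'p) \<Rightarrow> 'a" where
  "graded_sum3 t n p q r = (\<Sum>(i, j, k)\<in>tuples3 n. t (p i) (q j) (r k))"

lemma graded_sum3_permute:
  "graded_sum3 (\<lambda>p q r. t q r p) n p q r = graded_sum3 t n q r p"
  "graded_sum3 (\<lambda>p q r. t q p r) n p q r = graded_sum3 t n q p r"
  unfolding graded_sum3_def
  by (rule sum.reindex_bij_witness[of _ "\<lambda>(i, j, k). (k, i, j)" "\<lambda>(i, j, k). (j, k, i)"];
      force simp: tuples3_def)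
    (rule sum.reindex_bij_witness[of _ "\<lambda>(i, j, k). (j, i, k)" "\<lambda>(i, j, k). (j, i, k)"];
      force simp: tuples3_def)

text \<open>
  The coefficient of \<open>t\<^sup>n\<close> in the coboundary, with respect to the series \<open>p\<close>, of the associator of the
  series \<open>q\<close> and \<open>r\<close>.
\<close>

definition graded_pentagon ::
  "nat \<Rightarrow> (nat \<Rightarrow> 'a::ab_group_add \<Rightarrow> 'a \<Rightarrow> 'a) \<Rightarrow> (nat \<Rightarrow> 'a \<Rightarrow> 'a \<Rightarrow> 'a) \<Rightarrow> (nat \<Rightarrow> 'a \<Rightarrow> 'a \<Rightarrow> 'a) \<Rightarrow>
     'a \<Rightarrow> 'a \<Rightarrow> 'a \<Rightarrow> 'a \<Rightarrow> 'a" where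
  "graded_pentagon n p q r a b c d = (\<Sum>i\<le>n. coboundary3 (p i) (graded_associator q r (n - i)) a b c d)"

text \<open>
  The ten terms are the five ways to bracket \<open>a b c d\<close>, each met twice with opposite signs and with
  the three families in different places. In four bracketings \<open>p\<close> is outermost in one of the two terms
  and innermost in the other, where it multiplies two neighbouring arguments; in \<open>(a b) (c d)\<close> it is an
  inner product both times, on the left and on the right. Hence each difference vanishes once it is
  summed over all arrangements of the three families.
\<close>

lemma graded_pentagon_trees:
  fixes p q r :: "nat \<Rightarrow> 'a::ab_group_add \<Rightarrow> 'a \<Rightarrow> 'a" and a b c d :: 'a and n :: nat
  assumes p: "\<And>i. biadditive (p i)" and q: "\<And>i. biadditive (q i)"
  defines "t1 \<equiv> graded_sum3 (\<lambda>x y z :: 'a \<Rightarrow> 'a \<Rightarrow> 'a. x a (y (z b c) d)) n"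
    and "t2 \<equiv> graded_sum3 (\<lambda>x y z :: 'a \<Rightarrow> 'a \<Rightarrow> 'a. x a (y b (z c d))) n"
    and "t3 \<equiv> graded_sum3 (\<lambda>x y z :: 'a \<Rightarrow> 'a \<Rightarrow> 'a. x (y (z a b) c) d) n"
    and "t4 \<equiv> graded_sum3 (\<lambda>x y z :: 'a \<Rightarrow> 'a \<Rightarrow> 'a. x (y a (z b c)) d) n"
    and "t5 \<equiv> graded_sum3 (\<lambda>x y z :: 'a \<Rightarrow> 'a \<Rightarrow> 'a. x (y a b) (z c d)) n"
  shows "graded_pentagon n p q r a b c d =
      (t1 p q r - t1 q r p) - (t2 p q r - t2 q r p) + (t3 p q r - t3 q r p)
      - (t4 p q r - t4 q r p) + (t5 q p r - t5 q r p)"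
proof -
  let ?A = "\<lambda>y z a b c. y (z a b) c - y a (z b c) :: 'a"
  have "graded_pentagon n p q r a b c d =
      (\<Sum>i\<le>n. \<Sum>j\<le>n - i. coboundary3 (p i) (?A (q j) (r (n - i - j))) a b c d)"
    unfolding graded_pentagon_def graded_associator_def[abs_def] coboundary3_sum[OF p] ..
  also have "\<dots> = graded_sum3 (\<lambda>x y z. coboundary3 x (?A y z) a b c d) n p q r"
    unfolding graded_sum3_def
    by (rule sum_tuples3[where f = "\<lambda>i j k. coboundary3 (p i) (?A (q j) (r k)) a b c d"])
  also have "\<dots> = (t1 p q r - t1 q r p) - (t2 p q r - t2 q r p) + (t3 p q r - t3 q r p)
      - (t4 p q r - t4 q r p) + (t5 q p r - t5 q r p)"
    unfolding t1_def t2_def t3_def t4_def t5_def graded_sum3_permute[of _ n p q r, symmetric]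
    unfolding graded_sum3_def coboundary3_def sum.distrib[symmetric] sum_subtractf[symmetric]
    by (rule sum.cong) (auto simp: biadditive_simps[OF p] biadditive_simps[OF q] algebra_simps)
  finally show ?thesis .
qed

lemma graded_pentagon_diagonal:
  assumes "\<And>i. biadditive (p i)"
  shows "graded_pentagon n p p p a b c d = 0"
  by (simp add: graded_pentagon_trees assms)

lemma graded_pentagon_polarised:
  assumes "\<And>i. biadditive (p i)" "\<And>i. biadditive (q i)"
  shows "graded_pentagon n p p q a b c d + graded_pentagon n p q p a b c d
    + graded_pentagon n q p p a b c d = 0"
  by (simp add: graded_pentagon_trees assms)

section \<open>Adding a top coefficient\<close>

lemma graded_associator_extend_low:
  assumes "n \<le> N"
  shows "graded_associator (p(Suc N := \<nu>)) (q(Suc N := \<nu>')) n = graded_associator p q n"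
  using assms by (auto intro!: ext sum.cong simp: graded_associator_def) arith

text \<open>
  Only the two extreme summands of the convolution see the new coefficients. For \<open>p = q\<close> and
  \<open>\<nu> = \<nu>'\<close> the added terms form minus the Hochschild coboundary of \<open>\<nu>\<close> for the product \<open>p 0\<close>. Adding
  the same expression with the roles of \<open>(p, \<nu>)\<close> and \<open>(q, \<nu>')\<close> exchanged gives minus the coboundary of
  \<open>\<nu>'\<close> for \<open>p 0\<close> and that of \<open>\<nu>\<close> for \<open>q 0\<close>.
\<close>

lemma graded_associator_extend_top:
  assumes "p (Suc N) = 0" "q (Suc N) = 0" "biadditive (p 0)"
  shows "graded_associator (p(Suc N := \<nu>)) (q(Suc N := \<nu>')) (Suc N) a b c =
    graded_associator p q (Suc N) a b c
    + (p 0 (\<nu>' a b) c - p 0 a (\<nu>' b c)) + (\<nu> (q 0 a b) c - \<nu> a (q 0 b c))"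
proof -
  have "graded_associator (p(Suc N := \<nu>)) (q(Suc N := \<nu>')) (Suc N) a b c =
    (\<Sum>i\<le>Suc N. (p i (q (Suc N - i) a b) c - p i a (q (Suc N - i) b c))
      + (if i = 0 then p 0 (\<nu>' a b) c - p 0 a (\<nu>' b c) else 0)
      + (if i = Suc N then \<nu> (q 0 a b) c - \<nu> a (q 0 b c) else 0))"
    unfolding graded_associator_def
    by (rule sum.cong) (auto simp: assms(1,2) biadditive_simps[OF assms(3)])
  then show ?thesis by (simp add: graded_associator_def sum.distrib del: sum.atMost_Suc)
qed

section \<open>Cochains of low degree\<close>

definition cochain3 :: "('a::zero \<Rightarrow> 'a \<Rightarrow> 'a \<Rightarrow> 'a) \<Rightarrow> 'a list \<Rightarrow> 'a" where
  "cochain3 f xs = (if length xs = 3 then f (xs ! 0) (xs ! 1) (xs ! 2) else 0)"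

lemma all_less_3: "(\<forall>i<3. P i) \<longleftrightarrow> P 0 \<and> P 1 \<and> P (2::nat)"
  by (auto simp: numeral_3_eq_3 numeral_2_eq_2 less_Suc_eq)

context vector_space
begin

lemma cochain3_in_cochains:
  assumes "\<And>b c. Vector_Spaces.linear scale scale (\<lambda>x. f x b c)"
    and "\<And>a c. Vector_Spaces.linear scale scale (\<lambda>x. f a x c)"
    and "\<And>a b. Vector_Spaces.linear scale scale (\<lambda>x. f a b x)"
  shows "cochain3 f \<in> cochains scale 3"
proof -
  have "\<forall>i<3. Vector_Spaces.linear scale scale (\<lambda>x. cochain3 f (xs[i := x]))"
    if "length xs = 3" for xs
    unfolding all_less_3 using that assms by (simp add: cochain3_def)
  then show ?thesis by (auto simp: cochains_def cochain3_def)
qed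

lemma linear_graded_associator:
  assumes p: "\<And>i. bilinear_over scale (p i)"
    and q: "\<And>i. bilinear_over scale (q i)"
  shows "Vector_Spaces.linear scale scale (\<lambda>x. graded_associator p q n x b c)"
    and "Vector_Spaces.linear scale scale (\<lambda>x. graded_associator p q n a x c)"
    and "Vector_Spaces.linear scale scale (\<lambda>x. graded_associator p q n a b x)"
proof -
  have b: "biadditive (p i)" "biadditive (q i)" for i
    using p q by (simp_all add: bilinear_iff)
  note simps = biadditive_simps[OF b(1)] biadditive_simps[OF b(2)]
  show "Vector_Spaces.linear scale scale (\<lambda>x. graded_associator p q n x b c)"
    "Vector_Spaces.linear scale scale (\<lambda>x. graded_associator p q n a x c)"
    "Vector_Spaces.linear scale scale (\<lambda>x. graded_associator p q n a b x)"
    using p q unfolding Vector_Spaces.linear_iff bilinear_iff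
    by (simp_all add: vector_space_axioms graded_associator_def simps scale_sum_right
        scale_right_diff_distrib sum.distrib sum_subtractf)
qed

lemma hochschild_coboundary_cochain3:
  "hochschild_coboundary scale \<mu> 3 (cochain3 f) xs =
     (if length xs = 4 then coboundary3 \<mu> f (xs ! 0) (xs ! 1) (xs ! 2) (xs ! 3) else 0)"
proof (cases "length xs = 4")
  case True
  then obtain a b c d where "xs = [a, b, c, d]"
    by (auto simp: numeral_eq_Suc length_Suc_conv)
  then show ?thesis
    by (simp add: hochschild_coboundary_def cochain3_def coboundary3_def numeral_eq_Suc)
qed (simp add: hochschild_coboundary_def)

lemma hochschild_coboundary_2:
  "hochschild_coboundary scale \<mu> 2 g [a, b, c] =
     \<mu> a (g [b, c]) - g [\<mu> a b, c] + g [a, \<mu> b c] - \<mu> (g [a, b]) c"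
  by (simp add: hochschild_coboundary_def numeral_eq_Suc)

lemma bilinear_cochain2:
  assumes "g \<in> cochains scale 2"
  shows "bilinear_over scale (\<lambda>a b. g [a, b])"
proof -
  have "Vector_Spaces.linear scale scale (\<lambda>x. g ([a, b][i := x]))" if "i < 2" for a b i
    using assms that by (simp add: cochains_def del: list_update.simps)
  from this[of 0] this[of 1] show ?thesis
    by (auto simp: Vector_Spaces.linear_iff bilinear_iff intro!: biadditiveI)
qed

lemma compatible_cohomology_trivialD:
  assumes "biadditive \<mu>1" "biadditive \<mu>2"
    and H: "compatible_cohomology scale \<mu>1 \<mu>2 n = {compatible_coboundaries scale \<mu>1 \<mu>2 n}"
    and F: "F \<in> compatible_cocycles scale \<mu>1 \<mu>2 n"
  shows "F \<in> compatible_coboundaries scale \<mu>1 \<mu>2 n"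
proof -
  let ?r = "{(F, G). F \<in> compatible_cocycles scale \<mu>1 \<mu>2 n \<and> G \<in> compatible_cocycles scale \<mu>1 \<mu>2 n \<and>
                F - G \<in> compatible_coboundaries scale \<mu>1 \<mu>2 n}"
  have "Vector_Spaces.linear scale scale (\<lambda>x. 0)"
    by (simp add: Vector_Spaces.linear_iff vector_space_axioms)
  then have "0 \<in> compatible_cochains scale \<mu>1 \<mu>2 k" for k
    using assms(1,2) by (simp add: compatible_cochains_def cochains_def biadditive_simps)
  moreover have "hochschild_coboundary scale \<mu> k 0 = 0" if "biadditive \<mu>" for \<mu> k
    using that by (simp add: fun_eq_iff hochschild_coboundary_def biadditive_simps)
  then have "compatible_coboundary scale \<mu>1 \<mu>2 k 0 = 0" for k
    using assms(1,2) by (simp add: fun_eq_iff compatible_coboundary_def)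
  ultimately have "0 \<in> compatible_coboundaries scale \<mu>1 \<mu>2 n"
    unfolding compatible_coboundaries_def by (simp, metis imageI)
  \<comment> \<open>So the class of \<open>F\<close> contains \<open>F\<close>, and the only class is the set of coboundaries.\<close>
  then have "F \<in> ?r `` {F}" using F by simp
  moreover have "?r `` {F} \<in> {compatible_coboundaries scale \<mu>1 \<mu>2 n}"
    using F unfolding H[symmetric] compatible_cohomology_def by (rule quotientI)
  ultimately show ?thesis by (simp only: singleton_iff)
qed

end

section \<open>The obstruction to extending a deformation\<close>

definition obstruction ::
  "(nat \<Rightarrow> 'a::ab_group_add \<Rightarrow> 'a \<Rightarrow> 'a) \<Rightarrow> (nat \<Rightarrow> 'a \<Rightarrow> 'a \<Rightarrow> 'a) \<Rightarrow> nat \<Rightarrow> nat \<Rightarrow> 'a list \<Rightarrow> 'a" where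
  "obstruction m1 m2 n = (\<lambda>i.
     if i = 1 then cochain3 (graded_associator m1 m1 n)
     else if i = 2 then cochain3 (\<lambda>a b c. graded_associator m1 m2 n a b c + graded_associator m2 m1 n a b c)
     else if i = 3 then cochain3 (graded_associator m2 m2 n) else 0)"

context vector_space
begin

text \<open>
  In the pentagon identities of degree \<open>N + 1\<close> the associators of degree \<open>\<le> N\<close> vanish, or cancel after
  the two mixed ones are combined, so only the coboundaries for \<open>m1 0\<close> and \<open>m2 0\<close> of the obstruction
  remain. The identities with zero, one, two and three copies of \<open>m2\<close> give the four components.
\<close>

lemma obstruction_cocycle:
  assumes m1: "\<And>i. bilinear_over scale (m1 i)"
    and m2: "\<And>i. bilinear_over scale (m2 i)"
    and D: "\<forall>n\<le>N. deformation_equations m1 m2 n"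
  shows "obstruction m1 m2 (Suc N) \<in> compatible_cocycles scale (m1 0) (m2 0) 3"
proof -
  have b1: "biadditive (m1 i)" and b2: "biadditive (m2 i)" for i
    using m1 m2 by (simp_all add: bilinear_iff)
  have A: "\<forall>n\<le>N. \<forall>a b c. graded_associator m1 m1 n a b c = 0 \<and> graded_associator m2 m2 n a b c = 0 \<and>
        graded_associator m1 m2 n a b c + graded_associator m2 m1 n a b c = 0"
    using D by (simp add: deformation_equations_def)
  let ?n = "Suc N"
  let ?\<Theta> = "obstruction m1 m2 ?n"
  let ?mix = "\<lambda>n a b c. graded_associator m1 m2 n a b c + graded_associator m2 m1 n a b c"
  \<comment> \<open>If the family \<open>f\<close> starts in degree \<open>N + 1\<close>, only \<open>p 0\<close> contributes in that degree.\<close>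
  have leading: "(\<Sum>i\<le>?n. coboundary3 (p i) (f (?n - i)) a b c d) = coboundary3 (p 0) (f ?n) a b c d"
    if p: "\<And>i. biadditive (p i)" and f: "\<And>n x y z. n \<le> N \<Longrightarrow> f n x y z = 0"
    for p :: "nat \<Rightarrow> 'b \<Rightarrow> 'b \<Rightarrow> 'b" and f a b c d
  proof -
    have "coboundary3 (p i) (f (?n - i)) a b c d = 0" if "i \<in> {..?n} - {0}" for i
    proof -
      have "f (?n - i) = (\<lambda>x y z. 0)" using that by (intro ext f) auto
      then show ?thesis by (simp add: coboundary3_zero p)
    qed
    then show ?thesis
      using sum.mono_neutral_right[of "{..?n}" "{0}" "\<lambda>i. coboundary3 (p i) (f (?n - i)) a b c d"]
      by simp
  qed
  have e1: "coboundary3 (m1 0) (graded_associator m1 m1 ?n) a b c d = 0" for a b c d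
    using graded_pentagon_diagonal[of m1 ?n a b c d, OF b1] A
    by (simp add: graded_pentagon_def leading b1 del: sum.atMost_Suc)
  have e4: "coboundary3 (m2 0) (graded_associator m2 m2 ?n) a b c d = 0" for a b c d
    using graded_pentagon_diagonal[of m2 ?n a b c d, OF b2] A
    by (simp add: graded_pentagon_def leading b2 del: sum.atMost_Suc)
  have e2: "coboundary3 (m1 0) (?mix ?n) a b c d
      + coboundary3 (m2 0) (graded_associator m1 m1 ?n) a b c d = 0" for a b c d
  proof -
    have "graded_pentagon ?n m1 m1 m2 a b c d + graded_pentagon ?n m1 m2 m1 a b c d
        = (\<Sum>i\<le>?n. coboundary3 (m1 i) (?mix (?n - i)) a b c d)"
      by (simp add: graded_pentagon_def coboundary3_add[OF b1] sum.distrib del: sum.atMost_Suc)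
    also have "\<dots> = coboundary3 (m1 0) (?mix ?n) a b c d"
      by (rule leading) (use b1 A in auto)
    moreover have "graded_pentagon ?n m2 m1 m1 a b c d
        = coboundary3 (m2 0) (graded_associator m1 m1 ?n) a b c d"
      unfolding graded_pentagon_def by (rule leading) (use b2 A in auto)
    ultimately show ?thesis using graded_pentagon_polarised[of m1 m2 ?n a b c d] b1 b2 by simp
  qed
  have e3: "coboundary3 (m1 0) (graded_associator m2 m2 ?n) a b c d
      + coboundary3 (m2 0) (?mix ?n) a b c d = 0" for a b c d
  proof -
    have "graded_pentagon ?n m2 m1 m2 a b c d + graded_pentagon ?n m2 m2 m1 a b c d
        = (\<Sum>i\<le>?n. coboundary3 (m2 i) (?mix (?n - i)) a b c d)"
      by (simp add: graded_pentagon_def coboundary3_add[OF b2] sum.distrib del: sum.atMost_Suc)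
    also have "\<dots> = coboundary3 (m2 0) (?mix ?n) a b c d"
      by (rule leading) (use b2 A in auto)
    moreover have "graded_pentagon ?n m1 m2 m2 a b c d
        = coboundary3 (m1 0) (graded_associator m2 m2 ?n) a b c d"
      unfolding graded_pentagon_def by (rule leading) (use b1 A in auto)
    ultimately show ?thesis
      using graded_pentagon_polarised[of m2 m1 ?n a b c d] b1 b2 by (simp add: add_ac)
  qed
  note lin = linear_graded_associator
  have lin_add: "Vector_Spaces.linear scale scale (\<lambda>x. f x + g x)"
    if "Vector_Spaces.linear scale scale f" "Vector_Spaces.linear scale scale g" for f g
    using that by (simp add: Vector_Spaces.linear_iff scale_right_distrib algebra_simps)
  have "cochain3 (?mix ?n) \<in> cochains scale 3"
    by (intro cochain3_in_cochains lin_add lin m1 m2)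
  moreover have "cochain3 (graded_associator m1 m1 ?n) \<in> cochains scale 3"
    "cochain3 (graded_associator m2 m2 ?n) \<in> cochains scale 3"
    by (intro cochain3_in_cochains lin m1 m2)+
  ultimately have "?\<Theta> \<in> compatible_cochains scale (m1 0) (m2 0) 3"
    by (auto simp: compatible_cochains_def obstruction_def)
  moreover have "compatible_coboundary scale (m1 0) (m2 0) 3 ?\<Theta> i = 0" for i
  proof -
    consider "i = 1" | "i = 2" | "i = 3" | "i = 4" | "i = 0 \<or> i > 4" by linarith
    then show ?thesis
      by cases (auto simp: compatible_coboundary_def obstruction_def fun_eq_iff
          hochschild_coboundary_cochain3 e1 e2 e3 e4)
  qed
  ultimately show ?thesis by (simp add: compatible_cocycles_def fun_eq_iff)
qed

text \<open>
  The components of a compatible 2-cochain with coboundary \<open>\<Theta>\<close> are the coefficients to be added; the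
  three equations are the components of the coboundary.
\<close>

lemma exists_next_coefficient:
  assumes m1: "\<And>i. bilinear_over scale (m1 i)"
    and m2: "\<And>i. bilinear_over scale (m2 i)"
    and A: "\<forall>n\<le>N. deformation_equations m1 m2 n"
    and H: "compatible_cohomology scale (m1 0) (m2 0) 3 = {compatible_coboundaries scale (m1 0) (m2 0) 3}"
  obtains \<nu>1 \<nu>2 where
    "bilinear_over scale \<nu>1"
    "bilinear_over scale \<nu>2"
    "\<And>a b c. m1 0 a (\<nu>1 b c) - \<nu>1 (m1 0 a b) c + \<nu>1 a (m1 0 b c) - m1 0 (\<nu>1 a b) c
       = graded_associator m1 m1 (Suc N) a b c"
    "\<And>a b c. (m1 0 a (\<nu>2 b c) - \<nu>2 (m1 0 a b) c + \<nu>2 a (m1 0 b c) - m1 0 (\<nu>2 a b) c)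
         + (m2 0 a (\<nu>1 b c) - \<nu>1 (m2 0 a b) c + \<nu>1 a (m2 0 b c) - m2 0 (\<nu>1 a b) c)
       = graded_associator m1 m2 (Suc N) a b c + graded_associator m2 m1 (Suc N) a b c"
    "\<And>a b c. m2 0 a (\<nu>2 b c) - \<nu>2 (m2 0 a b) c + \<nu>2 a (m2 0 b c) - m2 0 (\<nu>2 a b) c
       = graded_associator m2 m2 (Suc N) a b c"
proof -
  have b: "biadditive (m1 0)" "biadditive (m2 0)"
    using m1 m2 by (simp_all add: bilinear_iff)
  from compatible_cohomology_trivialD[OF b H obstruction_cocycle[OF m1 m2 A]]
  obtain G where G: "G \<in> compatible_cochains scale (m1 0) (m2 0) 2"
    and eq: "compatible_coboundary scale (m1 0) (m2 0) 2 G = obstruction m1 m2 (Suc N)"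
    by (auto simp: compatible_coboundaries_def)
  have "G 1 \<in> cochains scale 2" "G 2 \<in> cochains scale 2"
    using G by (simp_all add: compatible_cochains_def)
  note bil = this[THEN bilinear_cochain2]
  have eq': "compatible_coboundary scale (m1 0) (m2 0) 2 G i [a, b, c] =
      (if i = 1 then graded_associator m1 m1 (Suc N) a b c
       else if i = 2 then graded_associator m1 m2 (Suc N) a b c + graded_associator m2 m1 (Suc N) a b c
       else if i = 3 then graded_associator m2 m2 (Suc N) a b c else 0)" for i a b c
    unfolding eq by (simp add: obstruction_def cochain3_def)
  show thesis
  proof (rule that[OF bil])
    fix a b c
    show "m1 0 a (G 1 [b, c]) - G 1 [m1 0 a b, c] + G 1 [a, m1 0 b c] - m1 0 (G 1 [a, b]) c
       = graded_associator m1 m1 (Suc N) a b c"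
      using eq'[of 1 a b c] by (simp add: compatible_coboundary_def hochschild_coboundary_2)
    show "(m1 0 a (G 2 [b, c]) - G 2 [m1 0 a b, c] + G 2 [a, m1 0 b c] - m1 0 (G 2 [a, b]) c)
         + (m2 0 a (G 1 [b, c]) - G 1 [m2 0 a b, c] + G 1 [a, m2 0 b c] - m2 0 (G 1 [a, b]) c)
       = graded_associator m1 m2 (Suc N) a b c + graded_associator m2 m1 (Suc N) a b c"
      using eq'[of 2 a b c] by (simp add: compatible_coboundary_def hochschild_coboundary_2)
    show "m2 0 a (G 2 [b, c]) - G 2 [m2 0 a b, c] + G 2 [a, m2 0 b c] - m2 0 (G 2 [a, b]) c
       = graded_associator m2 m2 (Suc N) a b c"
      using eq'[of 3 a b c] by (simp add: compatible_coboundary_def hochschild_coboundary_2)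
  qed
qed

lemma extensible_if_compatible_cohomology_trivial:
  assumes H: "compatible_cohomology scale \<mu>1 \<mu>2 3 = {compatible_coboundaries scale \<mu>1 \<mu>2 3}"
    and D: "finite_order_deformation scale \<mu>1 \<mu>2 N m1 m2"
  shows "extensible scale \<mu>1 \<mu>2 N m1 m2"
proof -
  have zero: "m1 i = 0 \<and> m2 i = 0" if "i > N" for i
    using D that by (simp add: finite_order_deformation_def)
  have m0: "m1 0 = \<mu>1" "m2 0 = \<mu>2" and "N \<ge> 1"
    using D by (simp_all add: finite_order_deformation_def)
  have bil: "bilinear_over scale (m1 i)
      \<and> bilinear_over scale (m2 i)" for i
    using D zero[of i] bilinear_zero
    by (cases "i \<le> N") (auto simp: finite_order_deformation_def)
  then have m1: "bilinear_over scale (m1 i)"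
    and m2: "bilinear_over scale (m2 i)" for i by blast+
  have b: "biadditive (m1 0)" "biadditive (m2 0)"
    using bil by (simp_all add: bilinear_iff)
  have A: "\<forall>n\<le>N. deformation_equations m1 m2 n"
    using D compatible_trunc_iff[OF m1 m2, of N] by (simp add: finite_order_deformation_def)
  obtain \<nu>1 \<nu>2 where \<nu>: "bilinear_over scale \<nu>1"
    "bilinear_over scale \<nu>2"
    and eq: "\<And>a b c. m1 0 a (\<nu>1 b c) - \<nu>1 (m1 0 a b) c + \<nu>1 a (m1 0 b c) - m1 0 (\<nu>1 a b) c
       = graded_associator m1 m1 (Suc N) a b c"
    "\<And>a b c. (m1 0 a (\<nu>2 b c) - \<nu>2 (m1 0 a b) c + \<nu>2 a (m1 0 b c) - m1 0 (\<nu>2 a b) c)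
         + (m2 0 a (\<nu>1 b c) - \<nu>1 (m2 0 a b) c + \<nu>1 a (m2 0 b c) - m2 0 (\<nu>1 a b) c)
       = graded_associator m1 m2 (Suc N) a b c + graded_associator m2 m1 (Suc N) a b c"
    "\<And>a b c. m2 0 a (\<nu>2 b c) - \<nu>2 (m2 0 a b) c + \<nu>2 a (m2 0 b c) - m2 0 (\<nu>2 a b) c
       = graded_associator m2 m2 (Suc N) a b c"
    using exists_next_coefficient[OF m1 m2 A H[folded m0]] by blast
  let ?m1 = "m1(Suc N := \<nu>1)" and ?m2 = "m2(Suc N := \<nu>2)"
  have z: "m1 (Suc N) = 0" "m2 (Suc N) = 0" using zero by simp_all
  note top = graded_associator_extend_top[of m1 N m1, OF z(1) z(1) b(1)]
    graded_associator_extend_top[of m1 N m2, OF z(1) z(2) b(1)]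
    graded_associator_extend_top[of m2 N m1, OF z(2) z(1) b(2)]
    graded_associator_extend_top[of m2 N m2, OF z(2) z(2) b(2)]
  have "graded_associator ?m1 ?m1 (Suc N) a b c = 0 \<and> graded_associator ?m2 ?m2 (Suc N) a b c = 0 \<and>
      graded_associator ?m1 ?m2 (Suc N) a b c + graded_associator ?m2 ?m1 (Suc N) a b c = 0" for a b c
  proof -
    have "graded_associator ?m1 ?m2 (Suc N) a b c + graded_associator ?m2 ?m1 (Suc N) a b c
      = (graded_associator m1 m2 (Suc N) a b c + graded_associator m2 m1 (Suc N) a b c)
       + (m1 0 (\<nu>2 a b) c - m1 0 a (\<nu>2 b c)) + (\<nu>1 (m2 0 a b) c - \<nu>1 a (m2 0 b c))
       + (m2 0 (\<nu>1 a b) c - m2 0 a (\<nu>1 b c)) + (\<nu>2 (m1 0 a b) c - \<nu>2 a (m1 0 b c))"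
      unfolding top by (simp add: algebra_simps)
    also have "\<dots> = 0" unfolding eq(2)[symmetric] by (simp add: algebra_simps)
    finally show ?thesis
      unfolding top eq(1)[symmetric] eq(3)[symmetric] by (simp add: algebra_simps)
  qed
  with A have A': "\<forall>n\<le>Suc N. deformation_equations ?m1 ?m2 n"
    by (simp add: le_Suc_eq deformation_equations_def graded_associator_extend_low)
  have n1: "bilinear_over scale (?m1 i)"
    and n2: "bilinear_over scale (?m2 i)" for i
    using m1 m2 \<nu> by simp_all
  have "finite_order_deformation scale \<mu>1 \<mu>2 (Suc N) ?m1 ?m2"
    unfolding finite_order_deformation_def compatible_trunc_iff[OF n1 n2]
    by (intro conjI A') (use n1 n2 zero m0 in auto)
  with \<nu> show ?thesis unfolding extensible_def by blast
qed

end

theorem corollary4p10: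
  fixes scale :: "'k::field_char_0 \<Rightarrow> 'a::ab_group_add \<Rightarrow> 'a"
    and Basis :: "'a set"
    and \<mu>1 \<mu>2 :: "'a \<Rightarrow> 'a \<Rightarrow> 'a"
    and N :: nat
    and m1 m2 :: "nat \<Rightarrow> 'a \<Rightarrow> 'a \<Rightarrow> 'a"
  assumes "finite_dimensional_vector_space scale Basis"
    and "compatible_associative_algebra scalar_ring (scalar_module scale) \<mu>1 \<mu>2"
    and "compatible_cohomology scale \<mu>1 \<mu>2 3 = {compatible_coboundaries scale \<mu>1 \<mu>2 3}"
    and "finite_order_deformation scale \<mu>1 \<mu>2 N m1 m2"
  shows "extensible scale \<mu>1 \<mu>2 N m1 m2"
proof -
  interpret finite_dimensional_vector_space scale Basis by fact
  show ?thesis using assms(3,4) by (rule extensible_if_compatible_cohomology_trivial)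
qed

end
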